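(* The motion equation of the variable-order fractional vibrator $$m\frac{d^{\alpha(\omega)}x(t)}{dt^{\alpha(\omega)}}+c\frac{d^{\beta(\omega)}x(t)}{dt^{\beta(\omega)}}+k\frac{d^{\lambda(\omega)}x(t)}{dt^{\lambda(\omega)}}=f(t)$$ is equivalently given by $$-\left[m\omega^{\alpha(\omega)-2}\cos\frac{\alpha(\omega)\pi}{2}+c\omega^{\beta(\omega)-2}\cos\frac{\beta(\omega)\pi}{2}\right]\frac{d^2x(t)}{dt^2}+\left[m\omega^{\alpha(\omega)-1}\sin\frac{\alpha(\omega)\pi}{2}+c\omega^{\beta(\omega)-1}\sin\frac{\beta(\omega)\pi}{2}+k\omega^{\lambda(\omega)-1}\sin\frac{\lambda(\omega)\pi}{2}\right]\frac{dx(t)}{dt}+k\omega^{\lambda(\omega)}\cos\frac{\lambda(\omega)\pi}{2}\,x(t)=f(t),$$ where $1<\alpha(\omega)<3$, $0<\beta(\omega)<2$, $0\le\lambda(\omega)<1$.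
   Context: $m$, $c$, $k$ are the constant primary mass, damping coefficient and stiffness of the vibrator; $x(t)$ is the displacement, with Fourier transform $X(\omega)=\mathrm{F}[x(t)]$, and $f(t)$ is the driving force. The orders $\alpha,\beta,\lambda$ are functions of the vibration frequency $\omega$. Fractional derivatives are Weyl fractional derivatives, for which $\mathrm{F}[x^{(v)}(t)]=(i\omega)^vX(\omega)$ for $v\ge0$, $i=\sqrt{-1}$; this rule is also used for variable order $v=v(\omega)$. Powers of $i$ take their principal value, $i^{v}=\cos\frac{v\pi}{2}+i\sin\frac{v\pi}{2}$, and $(i\omega)^v=\omega^v i^v$. In the second equation, coefficients depending on $\omega$ act in the Fourier domain by multiplication: the Fourier transform of $A(\omega)\frac{d^nx(t)}{dt^n}$ is $A(\omega)(i\omega)^nX(\omega)$. Equivalence means that the left-hand sides of the two equations are equal in the sense that they have the same Fourier transform (their difference is a null function). *)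

theory Defs
  imports "HOL-Analysis.Analysis"
begin

definition fourier :: "(real \<Rightarrow> real) \<Rightarrow> real \<Rightarrow> complex" where
  "fourier x \<omega> = (\<integral>t. of_real (x t) * exp (- (\<i> * of_real (\<omega> * t))) \<partial>lborel)"

(* Frequency-dependent operators determine their value only through its Fourier transform,
   hence only up to a null function; they are therefore relations between the signal x and
   a representative y of the result.

   The conditions are imposed at vibration frequencies w > 0, where the powers of w are real.
   Signals are real-valued, so that fourier y (-w) = cnj (fourier y w) and the positive
   frequencies determine y up to a null function. *)

(* y is the Weyl derivative of x of variable order v.  The complex power is the principal one:
   for w > 0, (i w)^v = w^v i^v = w^v (cos (v pi / 2) + i sin (v pi / 2)). *)
definition is_weyl_deriv ::
  "(real \<Rightarrow> real) \<Rightarrow> (real \<Rightarrow> real) \<Rightarrow> (real \<Rightarrow> real) \<Rightarrow> bool" where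
  "is_weyl_deriv v x y \<longleftrightarrow> integrable lborel x \<and> integrable lborel y \<and>
     (\<forall>\<omega>>0. fourier y \<omega> = (\<i> * of_real \<omega>) powr of_real (v \<omega>) * fourier x \<omega>)"

(* y is A(w) d^n x / dt^n, the coefficient acting by multiplication in the Fourier domain. *)
definition is_coeff_deriv ::
  "(real \<Rightarrow> real) \<Rightarrow> nat \<Rightarrow> (real \<Rightarrow> real) \<Rightarrow> (real \<Rightarrow> real) \<Rightarrow> bool" where
  "is_coeff_deriv A n x y \<longleftrightarrow> integrable lborel x \<and> integrable lborel y \<and>
     (\<forall>\<omega>>0. fourier y \<omega> = of_real (A \<omega>) * (\<i> * of_real \<omega>) ^ n * fourier x \<omega>)"

end

theory Submission
  imports Defs "HOL-Probability.Levy"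
begin

text \<open>
  Taking Fourier transforms turns both equations into multiplication of \<open>fourier x \<omega>\<close> by a complex
  function of \<open>\<omega>\<close>. For \<open>\<omega> > 0\<close> the principal power splits as
  \<open>(\<i> \<omega>)\<^sup>v = \<omega>\<^sup>v (cos (v \<pi> / 2) + \<i> sin (v \<pi> / 2))\<close>. The cosine parts of the two derivative terms
  are written with \<open>\<omega>\<^sup>v = - \<omega>\<^bsup>v-2\<^esup> (\<i> \<omega>)\<^sup>2\<close>, the sine parts of all three terms with
  \<open>\<i> \<omega>\<^sup>v = \<omega>\<^bsup>v-1\<^esup> (\<i> \<omega>)\<close>, and the cosine part of the stiffness term is left alone; collecting
  powers of \<open>\<i> \<omega>\<close> gives the multiplier of the second equation
  (\<open>fractional_symbol_eq_integer_order_symbol\<close>). Hence both left-hand sides have the same transform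
  at every positive frequency.

  It remains to see that a real integrable signal whose transform vanishes at all \<open>\<omega> > 0\<close> is null
  (\<open>AE_zero_if_fourier_zero_on_positive\<close>). The transform vanishes at \<open>\<omega> < 0\<close> by conjugate symmetry
  and at \<open>\<omega> = 0\<close> by continuity, so it vanishes everywhere. The value at \<open>0\<close> says that the positive
  and negative parts of the signal have the same mass. If this mass is not zero, both parts
  normalise to probability densities with the same characteristic function, and Levy's uniqueness
  theorem identifies them.
\<close>

section \<open>Elementary properties of the Fourier transform\<close>

lemma norm_fourier_kernel [simp]: "norm (exp (- (\<i> * of_real (\<omega> * t)))) = 1"
  using norm_exp_i_times[of "- (\<omega> * t)"] by simp

lemma integrable_fourier_integrand:
  fixes x :: "real \<Rightarrow> real"
  assumes "integrable lborel x"
  shows "integrable lborel (\<lambda>t. of_real (x t) * exp (- (\<i> * of_real (\<omega> * t))))"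
proof (rule Bochner_Integration.integrable_bound[OF assms])
  have [measurable]: "x \<in> borel_measurable lborel"
    using assms by simp
  have "(\<lambda>t::real. exp (- (\<i> * of_real (\<omega> * t)))) \<in> borel_measurable borel"
    by (intro borel_measurable_continuous_onI continuous_intros)
  then show "(\<lambda>t. of_real (x t) * exp (- (\<i> * of_real (\<omega> * t)))) \<in> borel_measurable lborel"
    by measurable
  show "AE t in lborel. norm (of_real (x t) * exp (- (\<i> * of_real (\<omega> * t)))) \<le> norm (x t)"
    by (simp add: norm_mult)
qed

lemma fourier_add:
  assumes "integrable lborel x" "integrable lborel y"
  shows "fourier (\<lambda>t. x t + y t) \<omega> = fourier x \<omega> + fourier y \<omega>"
  unfolding fourier_def
  by (subst Bochner_Integration.integral_add[OF integrable_fourier_integrand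
        integrable_fourier_integrand, OF assms, symmetric])
     (simp add: distrib_right)

lemma fourier_cmult: "fourier (\<lambda>t. a * x t) \<omega> = of_real a * fourier x \<omega>"
  unfolding fourier_def by (simp add: mult.assoc)

lemma fourier_diff:
  assumes "integrable lborel x" "integrable lborel y"
  shows "fourier (\<lambda>t. x t - y t) \<omega> = fourier x \<omega> - fourier y \<omega>"
  using fourier_add[OF assms(1) integrable_mult_right[OF assms(2), of "- 1"]]
    fourier_cmult[of "- 1" y]
  by simp

lemma fourier_minus_frequency: "fourier x (- \<omega>) = cnj (fourier x \<omega>)"
  unfolding fourier_def
  by (subst Bochner_Integration.integral_cnj[symmetric]) (simp add: exp_cnj)

lemma fourier_0: "fourier x 0 = of_real (\<integral>t. x t \<partial>lborel)"
  unfolding fourier_def by simp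

lemma fourier_cong_AE:
  assumes "integrable lborel x" "integrable lborel y" "AE t in lborel. x t = y t"
  shows "fourier x = fourier y"
proof
  fix \<omega>
  have "AE t in lborel. of_real (x t) * exp (- (\<i> * of_real (\<omega> * t)))
      = of_real (y t) * exp (- (\<i> * of_real (\<omega> * t)))"
    using assms(3) by eventually_elim simp
  then show "fourier x \<omega> = fourier y \<omega>"
    unfolding fourier_def
    using integrable_fourier_integrand[OF assms(1)] integrable_fourier_integrand[OF assms(2)]
    by (intro integral_cong_AE) auto
qed

text \<open>
  The integrand is dominated by the absolute value of the signal. The lemma
  serves to recover the mean value of the signal from its positive frequencies.
\<close>

lemma fourier_sequentially_continuous_at_0:
  assumes "integrable lborel x" and "w \<longlonglongrightarrow> 0"
  shows "(\<lambda>n. fourier x (w n)) \<longlonglongrightarrow> fourier x 0"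
  unfolding fourier_def
proof (rule integral_dominated_convergence[where w = "\<lambda>t. norm (x t)"])
  show "integrable lborel (\<lambda>t. norm (x t))"
    using assms(1) by simp
  show "(\<lambda>t. of_real (x t) * exp (- (\<i> * of_real (0 * t)))) \<in> borel_measurable lborel"
    by (rule borel_measurable_integrable[OF integrable_fourier_integrand[OF assms(1)]])
  show "(\<lambda>t. of_real (x t) * exp (- (\<i> * of_real (w n * t)))) \<in> borel_measurable lborel" for n
    by (rule borel_measurable_integrable[OF integrable_fourier_integrand[OF assms(1)]])
  have "(\<lambda>n. of_real (x t) * exp (- (\<i> * of_real (w n * t))))
      \<longlonglongrightarrow> of_real (x t) * exp (- (\<i> * of_real (0 * t)))" for t :: real
    by (intro tendsto_intros assms(2))
  then show "AE t in lborel. (\<lambda>n. of_real (x t) * exp (- (\<i> * of_real (w n * t))))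
      \<longlonglongrightarrow> of_real (x t) * exp (- (\<i> * of_real (0 * t)))"
    by blast
  show "AE t in lborel. norm (of_real (x t) * exp (- (\<i> * of_real (w n * t)))) \<le> norm (x t)" for n
    by (simp add: norm_mult)
qed

lemma fourier_zero_if_zero_on_positive:
  assumes "integrable lborel h" and pos: "\<And>\<omega>. \<omega> > 0 \<Longrightarrow> fourier h \<omega> = 0"
  shows "fourier h \<omega> = 0"
proof (cases \<omega> "0::real" rule: linorder_cases)
  case less
  then show ?thesis
    using fourier_minus_frequency[of h "- \<omega>"] pos[of "- \<omega>"] by simp
next
  case equal
  have "(\<lambda>n. fourier h (inverse (real (Suc n)))) \<longlonglongrightarrow> fourier h 0"
    by (rule fourier_sequentially_continuous_at_0[OF assms(1) LIMSEQ_inverse_real_of_nat])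
  then have "(\<lambda>n. 0) \<longlonglongrightarrow> fourier h 0"
    by (simp add: pos)
  then show ?thesis
    using equal by (simp add: LIMSEQ_const_iff)
qed (fact pos)


section \<open>Injectivity of the Fourier transform on integrable signals\<close>

lemma real_distribution_normalised_density:
  assumes "integrable lborel g" "\<And>t. 0 \<le> g t" "(\<integral>t. g t \<partial>lborel) = M" "M > 0"
  shows "real_distribution (density lborel (\<lambda>t. ennreal (g t / M)))"
proof -
  have "(\<integral>\<^sup>+t. ennreal (g t / M) \<partial>lborel) = ennreal (\<integral>t. g t / M \<partial>lborel)"
    using assms by (intro nn_integral_eq_integral) auto
  also have "\<dots> = 1"
    using assms by simp
  finally have "prob_space (density lborel (\<lambda>t. ennreal (g t / M)))"
    using assms(1) by (intro prob_spaceI) (simp add: emeasure_density cong: nn_integral_cong)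
  then show ?thesis
    by (simp add: real_distribution_def real_distribution_axioms_def)
qed

text \<open>
  The characteristic function uses the kernel \<open>exp (\<i> \<omega> t)\<close>, the Fourier transform its conjugate;
  this accounts for the sign of the frequency.
\<close>

lemma char_normalised_density:
  assumes "integrable lborel g" "\<And>t. 0 \<le> g t" "M > 0"
  shows "char (density lborel (\<lambda>t. ennreal (g t / M))) \<omega> = fourier g (- \<omega>) / of_real M"
proof -
  have [measurable]: "g \<in> borel_measurable lborel"
    using assms by simp
  have "char (density lborel (\<lambda>t. ennreal (g t / M))) \<omega>
      = (\<integral>t. (g t / M) *\<^sub>R iexp (\<omega> * t) \<partial>lborel)"
    unfolding char_def using assms by (intro integral_density) auto
  also have "\<dots> = (\<integral>t. (of_real (g t) * exp (- (\<i> * of_real (- \<omega> * t)))) / of_real M \<partial>lborel)"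
    by (simp add: scaleR_conv_of_real)
  also have "\<dots> = fourier g (- \<omega>) / of_real M"
    unfolding fourier_def by simp
  finally show ?thesis .
qed

text \<open>
  Injectivity for nonnegative signals is injectivity of the characteristic function of a
  distribution: the transform at \<open>0\<close> is the common mass by which both signals are normalised,
  unless it is zero, and then both signals are null.
\<close>

lemma AE_eq_if_fourier_eq_nonneg:
  assumes p: "integrable lborel p" "\<And>t. 0 \<le> p t"
    and q: "integrable lborel q" "\<And>t. 0 \<le> q t"
    and eq: "\<And>\<omega>. fourier p \<omega> = fourier q \<omega>"
  shows "AE t in lborel. p t = q t"
proof -
  define M where "M = (\<integral>t. p t \<partial>lborel)"
  have [measurable]: "p \<in> borel_measurable lborel" "q \<in> borel_measurable lborel"
    using p q by simp_all
  have Mq: "(\<integral>t. q t \<partial>lborel) = M"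
    using eq[of 0] by (simp add: fourier_0 M_def)
  have "M \<ge> 0"
    unfolding M_def using p by simp
  show ?thesis
  proof (cases "M = 0")
    case True
    have "AE t in lborel. p t = 0"
      using integral_nonneg_eq_0_iff_AE[OF p(1)] p(2) True by (simp add: M_def)
    moreover have "AE t in lborel. q t = 0"
      using integral_nonneg_eq_0_iff_AE[OF q(1)] q(2) True Mq by simp
    ultimately show ?thesis
      by eventually_elim simp
  next
    case False
    with \<open>M \<ge> 0\<close> have M: "M > 0"
      by simp
    have "density lborel (\<lambda>t. ennreal (p t / M)) = density lborel (\<lambda>t. ennreal (q t / M))"
      using real_distribution_normalised_density[OF p M_def[symmetric] M]
        real_distribution_normalised_density[OF q Mq M]
      by (rule Levy_uniqueness)
        (simp add: fun_eq_iff char_normalised_density p q M eq)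
    then have "AE t in lborel. ennreal (p t / M) = ennreal (q t / M)"
      by (subst (asm) sigma_finite_measure.density_unique_iff[OF lborel.sigma_finite_measure_axioms]) auto
    then show ?thesis
      using M p(2) q(2) by (auto elim!: eventually_mono)
  qed
qed

text \<open>Apply the nonnegative case to the positive and negative parts of the signal.\<close>

lemma AE_zero_if_fourier_zero_on_positive:
  assumes h: "integrable lborel h" and "\<And>\<omega>. \<omega> > 0 \<Longrightarrow> fourier h \<omega> = 0"
  shows "AE t in lborel. h t = 0"
proof -
  have int: "integrable lborel (\<lambda>t. max 0 (h t))" "integrable lborel (\<lambda>t. max 0 (- h t))"
    using h by auto
  have "h = (\<lambda>t. max 0 (h t) - max 0 (- h t))"
    by auto
  then have "fourier h \<omega> = fourier (\<lambda>t. max 0 (h t)) \<omega> - fourier (\<lambda>t. max 0 (- h t)) \<omega>" for \<omega>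
    using fourier_diff[OF int, of \<omega>] by simp
  then have "fourier (\<lambda>t. max 0 (h t)) \<omega> = fourier (\<lambda>t. max 0 (- h t)) \<omega>" for \<omega>
    using fourier_zero_if_zero_on_positive[OF assms, of \<omega>] by simp
  from AE_eq_if_fourier_eq_nonneg[OF int(1) _ int(2) _ this]
  have "AE t in lborel. max 0 (h t) = max 0 (- h t)"
    by simp
  then show ?thesis
    by eventually_elim auto
qed

lemma AE_eq_if_fourier_eq_on_positive:
  assumes "integrable lborel x" "integrable lborel y"
    and "\<And>\<omega>. \<omega> > 0 \<Longrightarrow> fourier x \<omega> = fourier y \<omega>"
  shows "AE t in lborel. x t = y t"
proof -
  have "AE t in lborel. x t - y t = 0"
    using assms by (intro AE_zero_if_fourier_zero_on_positive) (auto simp: fourier_diff)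
  then show ?thesis
    by eventually_elim simp
qed


section \<open>The multipliers of the two equations of motion\<close>

lemma ii_times_of_real_powr:
  assumes "\<omega> > 0"
  shows "(\<i> * of_real \<omega>) powr of_real v
    = of_real (\<omega> powr v) * (of_real (cos (v * pi / 2)) + \<i> * of_real (sin (v * pi / 2)))"
proof -
  have "Ln (\<i> * of_real \<omega>) = of_real (ln \<omega>) + \<i> * of_real (pi / 2)"
    using assms Ln_times_of_real[of \<omega> \<i>] by (simp add: mult.commute Ln_of_real)
  then have "(\<i> * of_real \<omega>) powr of_real v
      = exp (of_real (v * ln \<omega>) + \<i> * of_real (v * pi / 2))"
    using assms by (simp add: powr_def algebra_simps)
  also have "\<dots> = of_real (exp (v * ln \<omega>)) * cis (v * pi / 2)"
    by (simp only: exp_add exp_of_real cis_conv_exp)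
  finally show ?thesis
    using assms by (simp add: powr_def cis.ctr Complex_eq)
qed

text \<open>
  The real factor \<open>\<omega>\<^sup>v\<close> can trade two orders for \<open>- (\<i> \<omega>)\<^sup>2\<close>, with a real coefficient; the imaginary unit in front of the sines is absorbed by trading one order for \<open>\<i> \<omega>\<close>.
\<close>

lemma fractional_symbol_eq_integer_order_symbol:
  fixes m c k \<omega> a b l :: real
  assumes "\<omega> > 0"
  shows "of_real m * (\<i> * of_real \<omega>) powr of_real a + of_real c * (\<i> * of_real \<omega>) powr of_real b
       + of_real k * (\<i> * of_real \<omega>) powr of_real l
    = of_real (- (m * \<omega> powr (a - 2) * cos (a * pi / 2) + c * \<omega> powr (b - 2) * cos (b * pi / 2)))
        * (\<i> * of_real \<omega>) ^ 2
    + of_real (m * \<omega> powr (a - 1) * sin (a * pi / 2) + c * \<omega> powr (b - 1) * sin (b * pi / 2)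
             + k * \<omega> powr (l - 1) * sin (l * pi / 2)) * (\<i> * of_real \<omega>) ^ 1
    + of_real (k * \<omega> powr l * cos (l * pi / 2)) * (\<i> * of_real \<omega>) ^ 0"
proof -
  have shift: "\<omega> powr (v - 2) = \<omega> powr v / \<omega>\<^sup>2" "\<omega> powr (v - 1) = \<omega> powr v / \<omega>" for v
    using assms by (simp_all add: powr_diff)
  show ?thesis
    using assms unfolding ii_times_of_real_powr[OF assms] shift
    by (simp add: complex_eq_iff power2_eq_square field_simps)
qed


section \<open>Equivalence of the equations of motion\<close>

theorem theorem2p1:
  fixes m c k :: real
    and \<alpha> \<beta> lam :: "real \<Rightarrow> real"
    and x f x\<^sub>a x\<^sub>b x\<^sub>l y\<^sub>2 y\<^sub>1 y\<^sub>0 :: "real \<Rightarrow> real"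
  assumes "\<And>\<omega>. \<omega> > 0 \<Longrightarrow> 1 < \<alpha> \<omega> \<and> \<alpha> \<omega> < 3"
    and "\<And>\<omega>. \<omega> > 0 \<Longrightarrow> 0 < \<beta> \<omega> \<and> \<beta> \<omega> < 2"
    and "\<And>\<omega>. \<omega> > 0 \<Longrightarrow> 0 \<le> lam \<omega> \<and> lam \<omega> < 1"
    and "is_weyl_deriv \<alpha> x x\<^sub>a"
    and "is_weyl_deriv \<beta> x x\<^sub>b"
    and "is_weyl_deriv lam x x\<^sub>l"
    and "is_coeff_deriv
           (\<lambda>\<omega>. - (m * \<omega> powr (\<alpha> \<omega> - 2) * cos (\<alpha> \<omega> * pi / 2)
                   + c * \<omega> powr (\<beta> \<omega> - 2) * cos (\<beta> \<omega> * pi / 2)))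
           2 x y\<^sub>2"
    and "is_coeff_deriv
           (\<lambda>\<omega>. m * \<omega> powr (\<alpha> \<omega> - 1) * sin (\<alpha> \<omega> * pi / 2)
                + c * \<omega> powr (\<beta> \<omega> - 1) * sin (\<beta> \<omega> * pi / 2)
                + k * \<omega> powr (lam \<omega> - 1) * sin (lam \<omega> * pi / 2))
           1 x y\<^sub>1"
    and "is_coeff_deriv
           (\<lambda>\<omega>. k * \<omega> powr (lam \<omega>) * cos (lam \<omega> * pi / 2))
           0 x y\<^sub>0"
  shows "fourier (\<lambda>t. m * x\<^sub>a t + c * x\<^sub>b t + k * x\<^sub>l t) = fourier (\<lambda>t. y\<^sub>2 t + y\<^sub>1 t + y\<^sub>0 t)
       \<and> (AE t in lborel. m * x\<^sub>a t + c * x\<^sub>b t + k * x\<^sub>l t = y\<^sub>2 t + y\<^sub>1 t + y\<^sub>0 t)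
       \<and> ((AE t in lborel. m * x\<^sub>a t + c * x\<^sub>b t + k * x\<^sub>l t = f t)
            \<longleftrightarrow> (AE t in lborel. y\<^sub>2 t + y\<^sub>1 t + y\<^sub>0 t = f t))"
proof -
  let ?L = "\<lambda>t. m * x\<^sub>a t + c * x\<^sub>b t + k * x\<^sub>l t"
  let ?R = "\<lambda>t. y\<^sub>2 t + y\<^sub>1 t + y\<^sub>0 t"
  note weyl = assms(4-6)[unfolded is_weyl_deriv_def]
  note coeff = assms(7-9)[unfolded is_coeff_deriv_def]
  have [simp]: "integrable lborel x\<^sub>a" "integrable lborel x\<^sub>b" "integrable lborel x\<^sub>l"
      "integrable lborel y\<^sub>2" "integrable lborel y\<^sub>1" "integrable lborel y\<^sub>0"
    using weyl coeff by blast+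
  have int: "integrable lborel ?L" "integrable lborel ?R"
    by simp_all
  have "fourier ?L \<omega> = fourier ?R \<omega>" if \<omega>: "\<omega> > 0" for \<omega>
  proof -
    have "fourier ?L \<omega> = of_real m * fourier x\<^sub>a \<omega> + of_real c * fourier x\<^sub>b \<omega> + of_real k * fourier x\<^sub>l \<omega>"
      by (simp add: fourier_add fourier_cmult)
    also have "\<dots> = (of_real m * (\<i> * of_real \<omega>) powr of_real (\<alpha> \<omega>)
        + of_real c * (\<i> * of_real \<omega>) powr of_real (\<beta> \<omega>)
        + of_real k * (\<i> * of_real \<omega>) powr of_real (lam \<omega>)) * fourier x \<omega>"
      using weyl \<omega> by (simp add: distrib_right mult.assoc)
    also have "\<dots> = fourier y\<^sub>2 \<omega> + fourier y\<^sub>1 \<omega> + fourier y\<^sub>0 \<omega>"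
      using coeff \<omega> by (simp only: fractional_symbol_eq_integer_order_symbol distrib_right)
    also have "\<dots> = fourier ?R \<omega>"
      by (simp add: fourier_add)
    finally show ?thesis .
  qed
  then have AE: "AE t in lborel. ?L t = ?R t"
    by (rule AE_eq_if_fourier_eq_on_positive[OF int])
  \<comment> \<open>Equality at nonpositive frequencies comes back from the equality of the signals themselves.\<close>
  moreover have "fourier ?L = fourier ?R"
    by (rule fourier_cong_AE[OF int AE])
  moreover have "(AE t in lborel. ?L t = f t) \<longleftrightarrow> (AE t in lborel. ?R t = f t)"
    using AE by (rule eventually_subst[OF eventually_mono]) simp
  ultimately show ?thesis
    by blast
qed

end
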